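(* Let $L \geq 1$ and let $(H_n)_{n\ge 1}$ be the PLRS generated by coefficients $[c_1,\ldots,c_L]$, all of which are positive integers. Then $(H_n)$ is complete if and only if the coefficients are $[\underbrace{1,\ldots,1}_{L}]$ or $[\underbrace{1,\ldots,1}_{L-1},2]$.
   Context: A positive linear recurrence sequence (PLRS) generated by $[c_1,\ldots,c_L]$, where $L\ge 1$, the $c_i$ are nonnegative integers, $c_1\ge 1$ and $c_L\ge 1$, is the sequence of positive integers $(H_n)_{n\ge1}$ with $H_1=1$, $H_{n+1}=c_1H_n+c_2H_{n-1}+\cdots+c_nH_1+1$ for $1\le n<L$, and $H_{n+1}=c_1H_n+\cdots+c_LH_{n+1-L}$ for $n\ge L$. A sequence of positive integers $(a_i)_{i\ge1}$ is complete if every positive integer $n$ can be written as $n=\sum_{i=1}^\infty \varepsilon_i a_i$ with $\varepsilon_i\in\{0,1\}$; otherwise it is incomplete. When $L=1$, $[\underbrace{1,\ldots,1}_{L-1},2]$ means $[2]$. *)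

theory Defs imports Complex_Main begin

text \<open>The sequence generated by \<open>cs = [c\<^sub>1, \<dots>, c\<^sub>L]\<close>, indexed from 1.
  The coefficient \<open>c\<^sub>i\<close> is \<open>cs ! (i - 1)\<close>, and the value at index 0 is junk.
  In the last equation, \<open>Suc n\<close> is the index called \<open>n\<close> in the recurrence for
  \<open>H\<^bsub>n+1\<^esub>\<close>.\<close>

fun plrs :: "nat list \<Rightarrow> nat \<Rightarrow> nat" where
  "plrs cs 0 = 0"
| "plrs cs (Suc 0) = 1"
| "plrs cs (Suc (Suc n)) =
     (if Suc n < length cs
      then (\<Sum>i = 1..Suc n. cs ! (i - 1) * plrs cs (Suc n + 1 - i)) + 1
      else (\<Sum>i = 1..length cs. cs ! (i - 1) * plrs cs (Suc n + 1 - i)))"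

text \<open>Well-formedness of the coefficients makes all terms with positive index positive.\<close>

lemma plrs_pos:
  assumes "cs \<noteq> []" "hd cs \<ge> 1" "n \<ge> 1"
  shows "plrs cs n > 0"
  using assms(3)
proof (induction n rule: nat_induct_at_least)
  case base
  show ?case by simp
next
  case (Suc n)
  then obtain m where m: "n = Suc m" by (cases n) auto
  have c: "cs ! 0 * plrs cs (Suc m) > 0"
    using Suc assms m by (simp add: hd_conv_nth)
  have "(\<Sum>i = 1..length cs. cs ! (i - 1) * plrs cs (Suc m + 1 - i))
          \<ge> cs ! (1 - 1) * plrs cs (Suc m + 1 - 1)"
    using assms(1) by (intro member_le_sum) (auto simp: Suc_le_eq)
  with c have "(\<Sum>i = 1..length cs. cs ! (i - 1) * plrs cs (Suc m + 1 - i)) > 0"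
    unfolding diff_self_eq_0 add_diff_cancel_right' by linarith
  then show ?case unfolding m plrs.simps by simp
qed

text \<open>For positive terms the series converges in the discrete space of natural numbers only
  if all but finitely many of the \<open>\<epsilon> i\<close> vanish.  Indices start at 1, hence the shift.\<close>

definition complete_seq :: "(nat \<Rightarrow> nat) \<Rightarrow> bool" where
  "complete_seq a \<longleftrightarrow>
     (\<forall>n \<ge> 1. \<exists>\<epsilon>. (\<forall>i \<ge> 1. \<epsilon> i \<in> {0, 1}) \<and> (\<lambda>i. \<epsilon> (Suc i) * a (Suc i)) sums n)"

end

theory Submission imports Defs begin

text \<open>By Brown's criterion, a nondecreasing sequence is complete iff every term exceeds the sum
  \<open>S\<close> of the preceding ones by at most 1. If \<open>c\<^sub>i \<ge> 2\<close> for some \<open>i < L\<close>, the term \<open>c\<^sub>i H\<^sub>1\<close> and the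
  additive 1 give \<open>H\<^bsub>i+1\<^esub> \<ge> S\<^sub>i + 2\<close>; if \<open>c\<^sub>L \<ge> 3\<close>, then \<open>H\<^bsub>L+1\<^esub> \<ge> S\<^sub>L + 2\<close>. Conversely, for the
  two exceptional coefficient lists, \<open>H\<^bsub>n+1\<^esub> \<le> (S\<^sub>n - S\<^bsub>n-L\<^esub>) + H\<^bsub>n-L+1\<^esub>\<close> for \<open>n \<ge> L\<close>, and
  induction applies to the last summand.\<close>

lemma nat_sums_iff_eventually_eq:
  fixes f :: "nat \<Rightarrow> nat"
  shows "f sums n \<longleftrightarrow> (\<forall>\<^sub>F m in sequentially. sum f {..<m} = n)"
  by (simp add: sums_def tendsto_discrete)

text \<open>Greedy choice from the top: if \<open>n\<close> exceeds the sum of the first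
  \<open>k\<close> terms, then \<open>b k \<le> n\<close>, and the remainder \<open>n - b k\<close>
  is within reach of those terms.\<close>

lemma subset_sum_of_Brown:
  fixes b :: "nat \<Rightarrow> nat"
  assumes "\<And>k. b k \<le> 1 + sum b {..<k}" "n \<le> sum b {..<k}"
  shows "\<exists>A\<subseteq>{..<k}. sum b A = n"
  using assms(2)
proof (induction k arbitrary: n)
  case 0
  then show ?case by simp
next
  case (Suc k)
  show ?case
  proof (cases "n \<le> sum b {..<k}")
    case True
    with Suc.IH obtain A where "A \<subseteq> {..<k}" "sum b A = n" by blast
    then show ?thesis by (intro exI[of _ A]) auto
  next
    case False
    with assms(1)[of k] have le: "b k \<le> n" by linarith
    from Suc.prems have "n - b k \<le> sum b {..<k}" by simp
    with Suc.IH obtain A where A: "A \<subseteq> {..<k}" "sum b A = n - b k" by blast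
    then have "finite A" "k \<notin> A" by (auto intro: finite_subset)
    with A le have "sum b (insert k A) = n" by simp
    with A show ?thesis by (intro exI[of _ "insert k A"]) auto
  qed
qed

text \<open>Positivity makes the first \<open>n\<close> terms add up to at least \<open>n\<close>,
  so a subset of them already suffices to represent \<open>n\<close>.\<close>

lemma complete_seq_if_Brown:
  assumes Brown: "\<And>k. a (Suc k) \<le> 1 + (\<Sum>i<k. a (Suc i))"
    and pos: "\<And>k. a (Suc k) > 0"
  shows "complete_seq a"
  unfolding complete_seq_def
proof (intro allI impI)
  fix n :: nat
  have "(\<Sum>i<n. 1) \<le> (\<Sum>i<n. a (Suc i))"
    using pos by (intro sum_mono) (simp add: Suc_le_eq)
  then have "n \<le> (\<Sum>i<n. a (Suc i))" by simp
  from subset_sum_of_Brown[of "\<lambda>i. a (Suc i)", OF Brown this]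
  obtain A where A: "A \<subseteq> {..<n}" "(\<Sum>i\<in>A. a (Suc i)) = n" by blast
  \<comment> \<open>\<open>A\<close> holds zero-based positions, whereas \<open>\<epsilon>\<close>
    is indexed from 1.\<close>
  define \<epsilon> :: "nat \<Rightarrow> nat" where "\<epsilon> i = of_bool (i - 1 \<in> A)" for i
  have "(\<lambda>i. \<epsilon> (Suc i) * a (Suc i)) sums (\<Sum>i\<in>A. \<epsilon> (Suc i) * a (Suc i))"
    using A by (intro sums_finite) (auto simp: \<epsilon>_def intro: finite_subset)
  also have "(\<Sum>i\<in>A. \<epsilon> (Suc i) * a (Suc i)) = n"
    using A by (simp add: \<epsilon>_def)
  finally show "\<exists>\<epsilon>. (\<forall>i\<ge>1. \<epsilon> i \<in> {0, 1}) \<and> (\<lambda>i. \<epsilon> (Suc i) * a (Suc i)) sums n"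
    by (intro exI[of _ \<epsilon>]) (auto simp: \<epsilon>_def)
qed

text \<open>A gap before \<open>a (Suc k)\<close> leaves \<open>S + 1\<close> without a
  representation: by monotonicity every term from there on is too large, and all earlier ones
  together give only \<open>S\<close>.\<close>

lemma Brown_if_complete_seq:
  assumes "complete_seq a" and mono: "mono (\<lambda>i. a (Suc i))"
  shows "a (Suc k) \<le> 1 + (\<Sum>i<k. a (Suc i))"
proof (rule ccontr)
  define S where "S = (\<Sum>i<k. a (Suc i))"
  assume "\<not> ?thesis"
  then have gap: "S + 1 < a (Suc k)" by (simp add: S_def)
  from assms(1) obtain \<epsilon> where \<epsilon>: "\<And>i. i \<ge> 1 \<Longrightarrow> \<epsilon> i \<in> {0, 1}"
    and "(\<lambda>i. \<epsilon> (Suc i) * a (Suc i)) sums (S + 1)"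
    unfolding complete_seq_def by (metis le_add2)
  then obtain N where N: "\<And>m. m \<ge> N \<Longrightarrow> (\<Sum>i<m. \<epsilon> (Suc i) * a (Suc i)) = S + 1"
    by (auto simp: nat_sums_iff_eventually_eq eventually_sequentially)
  \<comment> \<open>Beyond \<open>N\<close> the partial sums are constant; beyond \<open>k\<close>
    they include every term counted in \<open>S\<close>.\<close>
  define m where "m = max N k"
  have sum_m: "(\<Sum>i<m. \<epsilon> (Suc i) * a (Suc i)) = S + 1"
    by (rule N) (simp add: m_def)
  have zero: "\<epsilon> (Suc i) = 0" if "i < m" "k \<le> i" for i
  proof (rule ccontr)
    assume "\<epsilon> (Suc i) \<noteq> 0"
    with \<epsilon>[of "Suc i"] have "a (Suc i) = \<epsilon> (Suc i) * a (Suc i)" by simp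
    also have "\<dots> \<le> (\<Sum>i<m. \<epsilon> (Suc i) * a (Suc i))"
      using that by (intro member_le_sum) auto
    finally show False
      using gap sum_m monoD[OF mono that(2)] by simp
  qed
  have "S + 1 = (\<Sum>i<k. \<epsilon> (Suc i) * a (Suc i))"
    unfolding sum_m[symmetric] using zero by (intro sum.mono_neutral_right) (auto simp: m_def)
  also have "\<dots> \<le> (\<Sum>i<k. 1 * a (Suc i))"
    using \<epsilon> by (intro sum_mono mult_right_mono) (fastforce simp: le_Suc_eq)+
  finally show False by (simp add: S_def)
qed

text \<open>Merges both branches of the recurrence into one zero-based sum; indices of the form
  \<open>Suc j\<close> never meet the junk value at 0.\<close>

lemma plrs_Suc:
  assumes "n \<ge> 1"
  shows "plrs cs (Suc n) =
    (\<Sum>i<min n (length cs). cs ! i * plrs cs (Suc (n - Suc i))) + of_bool (n < length cs)"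
proof -
  obtain k where k: "n = Suc k" using assms by (cases n) auto
  have "(\<Sum>i = 1..m. cs ! (i - 1) * plrs cs (Suc k + 1 - i)) =
      (\<Sum>i<m. cs ! i * plrs cs (Suc (n - Suc i)))" if "m \<le> n" for m
  proof -
    have "(\<Sum>i = 1..m. cs ! (i - 1) * plrs cs (Suc k + 1 - i)) =
        (\<Sum>i<m. cs ! i * plrs cs (Suc k - i))"
      unfolding atLeastLessThanSuc_atLeastAtMost[symmetric] One_nat_def
      by (simp add: sum.shift_bounds_Suc_ivl lessThan_atLeast0 del: sum.op_ivl_Suc)
    also have "\<dots> = (\<Sum>i<m. cs ! i * plrs cs (Suc (n - Suc i)))"
      using that k by (intro sum.cong) (auto simp: Suc_diff_le)
    finally show ?thesis .
  qed
  then show ?thesis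
    unfolding k plrs.simps by (auto simp: min_def simp del: plrs.simps)
qed

lemma mono_plrs_Suc:
  assumes "cs \<noteq> []" "cs ! 0 \<ge> 1"
  shows "mono (\<lambda>n. plrs cs (Suc n))"
proof (rule mono_iff_le_Suc[THEN iffD2], rule allI)
  fix n
  \<comment> \<open>The index is left unsimplified to match the summand \<open>i = 0\<close> of the
    recurrence.\<close>
  have "plrs cs (Suc n) \<le> cs ! 0 * plrs cs (Suc (Suc n - Suc 0))"
    using assms(2) by simp
  also have "\<dots> \<le> (\<Sum>i<min (Suc n) (length cs). cs ! i * plrs cs (Suc (Suc n - Suc i)))"
    by (rule member_le_sum) (use assms(1) in auto)
  also have "\<dots> \<le> plrs cs (Suc (Suc n))"
    using plrs_Suc[of "Suc n" cs] by linarith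
  finally show "plrs cs (Suc n) \<le> plrs cs (Suc (Suc n))" .
qed

text \<open>The coefficient of \<open>H\<^sub>1\<close> in the recurrence for \<open>H\<^bsub>k+2\<^esub>\<close> is \<open>cs ! k\<close>.\<close>

lemma plrs_lower_bound:
  assumes "k < length cs" "\<forall>c \<in> set cs. c \<ge> 1"
  shows "(\<Sum>i<Suc k. plrs cs (Suc i)) + cs ! k + of_bool (Suc k < length cs)
    \<le> plrs cs (Suc (Suc k)) + 1"
proof -
  have "(\<Sum>i<Suc k. plrs cs (Suc i)) = (\<Sum>i<Suc k. plrs cs (Suc (Suc k - Suc i)))"
    by (rule sum.nat_diff_reindex[symmetric])
  \<comment> \<open>The summand split off at \<open>i = k\<close> is the first term of the sequence,
    which is 1.\<close>
  also have "\<dots> = (\<Sum>i<k. plrs cs (Suc (k - i))) + 1"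
    by simp
  also have "\<dots> \<le> (\<Sum>i<k. cs ! i * plrs cs (Suc (k - i))) + 1"
    using assms by (intro add_right_mono sum_mono) simp
  finally have "(\<Sum>i<Suc k. plrs cs (Suc i)) \<le> (\<Sum>i<k. cs ! i * plrs cs (Suc (k - i))) + 1" .
  moreover have "plrs cs (Suc (Suc k)) =
      (\<Sum>i<k. cs ! i * plrs cs (Suc (k - i))) + cs ! k + of_bool (Suc k < length cs)"
    using assms(1) by (subst plrs_Suc) (simp_all add: min_absorb1)
  ultimately show ?thesis by linarith
qed

text \<open>The recurrence lists the latest \<open>l\<close> terms in descending order; this joins
  them to the first \<open>m\<close> terms.\<close>

lemma sum_lessThan_add_rev:
  fixes b :: "nat \<Rightarrow> 'a::comm_monoid_add"
  shows "(\<Sum>i<l. b (m + l - Suc i)) + sum b {..<m} = sum b {..<m + l}"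
proof (induction l)
  case 0
  show ?case by simp
next
  case (Suc l)
  have "(\<Sum>i<Suc l. b (m + Suc l - Suc i)) = b (m + l) + (\<Sum>i<l. b (m + l - Suc i))"
    by (subst sum.lessThan_Suc_shift) simp
  with Suc.IH have "(\<Sum>i<Suc l. b (m + Suc l - Suc i)) + sum b {..<m} = b (m + l) + sum b {..<m + l}"
    by (simp only: add.assoc)
  then show ?case by (simp only: add_Suc_right sum.lessThan_Suc add.commute)
qed

lemma plrs_Brown:
  assumes "cs \<noteq> []" "\<And>i. Suc i < length cs \<Longrightarrow> cs ! i = 1" "last cs \<le> 2"
  shows "plrs cs (Suc n) \<le> 1 + (\<Sum>i<n. plrs cs (Suc i))"
proof (induction n rule: less_induct)
  case (less n)
  consider "n = 0" | "n \<ge> 1" "n < length cs" | "n \<ge> length cs" by linarith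
  then show ?case
  proof cases
    case 1
    then show ?thesis by simp
  next
    case 2
    \<comment> \<open>Only coefficients before the last one occur here, so the Brown bound holds
      with equality.\<close>
    then have "plrs cs (Suc n) = (\<Sum>i<n. plrs cs (Suc (n - Suc i))) + 1"
      using assms(2) by (simp add: plrs_Suc min_absorb1)
    then show ?thesis
      using sum.nat_diff_reindex[of "\<lambda>i. plrs cs (Suc i)" n] by simp
  next
    case 3
    obtain l where l: "length cs = Suc l" using assms(1) by (cases cs) auto
    define m where "m = n - length cs"
    have n: "n = m + Suc l" using 3 l by (simp add: m_def)
    have last: "cs ! l \<le> 2" using assms l by (simp add: last_conv_nth)
    have "plrs cs (Suc n) = (\<Sum>i<Suc l. cs ! i * plrs cs (Suc (n - Suc i)))"
      using n l by (subst plrs_Suc) simp_all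
    also have "\<dots> = (\<Sum>i<l. plrs cs (Suc (n - Suc i))) + cs ! l * plrs cs (Suc m)"
      using assms(2) l n by simp
    \<comment> \<open>Rounding the last coefficient up to 2 treats both lists at once. One copy of
      \<open>plrs cs (Suc m)\<close> completes the block of the latest \<open>Suc l\<close> terms;
      the other is bounded by induction.\<close>
    also have "\<dots> \<le> (\<Sum>i<l. plrs cs (Suc (n - Suc i))) + 2 * plrs cs (Suc m)"
      using last by (intro add_left_mono mult_right_mono) auto
    also have "\<dots> = (\<Sum>i<Suc l. plrs cs (Suc (n - Suc i))) + plrs cs (Suc m)"
      using n by simp
    also have "plrs cs (Suc m) \<le> 1 + (\<Sum>i<m. plrs cs (Suc i))"
      using n by (intro less.IH) simp
    also have "(\<Sum>i<Suc l. plrs cs (Suc (n - Suc i))) + (1 + (\<Sum>i<m. plrs cs (Suc i)))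
        = 1 + (\<Sum>i<n. plrs cs (Suc i))"
      using sum_lessThan_add_rev[of "\<lambda>i. plrs cs (Suc i)" m "Suc l"] n by simp
    finally show ?thesis by simp
  qed
qed

theorem theorem1p11:
  fixes L :: nat and cs :: "nat list"
  assumes "L \<ge> 1" and "length cs = L" and "\<forall>c \<in> set cs. c \<ge> 1"
  shows "complete_seq (plrs cs) \<longleftrightarrow>
           cs = replicate L 1 \<or> cs = replicate (L - 1) 1 @ [2]"
proof
  assume complete: "complete_seq (plrs cs)"
  have ne: "cs \<noteq> []" using assms by auto
  have ge1: "cs ! i \<ge> 1" if "i < L" for i using assms that by simp
  have "mono (\<lambda>n. plrs cs (Suc n))"
    using ne ge1[of 0] assms(1) by (intro mono_plrs_Suc) auto
  note Brown = Brown_if_complete_seq[OF complete this]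
  \<comment> \<open>The indicator carries the additive 1 of the recurrence: it caps all coefficients
    but the last at 1, and the last at 2.\<close>
  have coeff: "cs ! k + of_bool (Suc k < L) \<le> 2" if "k < L" for k
    using Brown[of "Suc k"] plrs_lower_bound[of k cs, unfolded assms(2), OF that assms(3)]
    by linarith
  have "butlast cs = replicate (L - 1) 1"
  proof (rule nth_equalityI)
    fix i assume "i < length (butlast cs)"
    then have "i < L" "Suc i < L" using assms(2) by simp_all
    with coeff[of i] ge1[of i] assms(2) show "butlast cs ! i = replicate (L - 1) 1 ! i"
      by (simp add: nth_butlast less_diff_conv)
  qed (simp add: assms(2))
  then have cs: "cs = replicate (L - 1) 1 @ [last cs]"
    using append_butlast_last_id[OF ne] by simp
  have "last cs = 1 \<or> last cs = 2"
    using coeff[of "L - 1"] ge1[of "L - 1"] assms(1,2) ne by (auto simp: last_conv_nth)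
  moreover have "replicate (L - 1) 1 @ [1] = replicate L (1::nat)"
    using assms(1) by (metis Suc_diff_1 less_eq_Suc_le One_nat_def replicate_Suc replicate_append_same)
  ultimately show "cs = replicate L 1 \<or> cs = replicate (L - 1) 1 @ [2]"
    using cs by metis
next
  assume cs: "cs = replicate L 1 \<or> cs = replicate (L - 1) 1 @ [2]"
  have ne: "cs \<noteq> []" using assms by auto
  have coeff: "cs ! i = 1" if "Suc i < L" for i
    using cs that by (auto simp: nth_append)
  have last: "last cs \<le> 2"
    using cs assms(1) by (auto simp: last_replicate)
  show "complete_seq (plrs cs)"
  proof (rule complete_seq_if_Brown)
    show "plrs cs (Suc k) \<le> 1 + (\<Sum>i<k. plrs cs (Suc i))" for k
      by (rule plrs_Brown[OF ne _ last]) (simp add: coeff assms(2))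
    show "plrs cs (Suc k) > 0" for k
      using ne assms(3) by (intro plrs_pos) auto
  qed
qed

end
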